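(* Let $X$ be a quiver. Then the free category $F_X$, freely generated by $X$, is residually finite.
   Context: A quiver is a quadruple $(V,E,s,t)$ consisting of a set $V$ (vertices), a set $E$ (edges), and two maps $s,t\colon E\to V$ (source and target); $V$ and $E$ may be infinite. The free category $F_X$ has object set $V$; morphisms from $u$ to $v$ are the finite directed paths from $u$ to $v$ (including the empty path at each vertex), with concatenation as composition. A category $D$ is finite if its collection of objects is finite and all sets $\mathrm{Mor}_D(X,Y)$ are finite. Two morphisms $f\in \mathrm{Mor}_C(X,Y)$, $g\in\mathrm{Mor}_C(X',Y')$ of a category $C$ are considered equal if and only if $X=X'$, $Y=Y'$ and $f=g$. A category $C$ is residually finite if for all morphisms $f,g$ in $C$ with $f\neq g$ there exist a finite category $D$ and a functor $F\colon C\to D$ with $F(f)\neq F(g)$. *)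

theory Defs
  imports "Graph_Theory.Digraph" "Graph_Theory.Arc_Walk"
begin

text \<open>
  A category is given by a set of objects and a family of hom-sets indexed by pairs of objects.
  Hom-sets need not be disjoint: a morphism of the category is a triple (x, y, f) with f in
  Mor C x y, so that equality of morphisms includes equality of domains and of codomains.
  Composition is written in diagrammatic order: for f from x to y and g from y to z, the
  composite, first f and then g, is Cmp C x y z f g.
\<close>

record ('o, 'm) precategory =
  Obj :: "'o set"
  Mor :: "'o \<Rightarrow> 'o \<Rightarrow> 'm set"
  Idt :: "'o \<Rightarrow> 'm"
  Cmp :: "'o \<Rightarrow> 'o \<Rightarrow> 'o \<Rightarrow> 'm \<Rightarrow> 'm \<Rightarrow> 'm"

locale category =
  fixes C :: "('o, 'm) precategory"
  assumes Idt_in: "x \<in> Obj C \<Longrightarrow> Idt C x \<in> Mor C x x"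
    and Cmp_in: "\<lbrakk>x \<in> Obj C; y \<in> Obj C; z \<in> Obj C; f \<in> Mor C x y; g \<in> Mor C y z\<rbrakk>
      \<Longrightarrow> Cmp C x y z f g \<in> Mor C x z"
    and Cmp_Idt_left: "\<lbrakk>x \<in> Obj C; y \<in> Obj C; f \<in> Mor C x y\<rbrakk> \<Longrightarrow> Cmp C x x y (Idt C x) f = f"
    and Cmp_Idt_right: "\<lbrakk>x \<in> Obj C; y \<in> Obj C; f \<in> Mor C x y\<rbrakk> \<Longrightarrow> Cmp C x y y f (Idt C y) = f"
    and Cmp_assoc: "\<lbrakk>w \<in> Obj C; x \<in> Obj C; y \<in> Obj C; z \<in> Obj C;
        f \<in> Mor C w x; g \<in> Mor C x y; h \<in> Mor C y z\<rbrakk>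
      \<Longrightarrow> Cmp C w y z (Cmp C w x y f g) h = Cmp C w x z f (Cmp C x y z g h)"

locale finite_category = category D for D :: "('o, 'm) precategory" +
  assumes finite_Obj: "finite (Obj D)"
    and finite_Mor: "\<lbrakk>x \<in> Obj D; y \<in> Obj D\<rbrakk> \<Longrightarrow> finite (Mor D x y)"

locale category_functor = C: category C + D: category D
  for C :: "('o, 'm) precategory" and D :: "('p, 'n) precategory"
    and Fo :: "'o \<Rightarrow> 'p" and Fm :: "'o \<Rightarrow> 'o \<Rightarrow> 'm \<Rightarrow> 'n" +
  assumes Fo_in: "x \<in> Obj C \<Longrightarrow> Fo x \<in> Obj D"
    and Fm_in: "\<lbrakk>x \<in> Obj C; y \<in> Obj C; f \<in> Mor C x y\<rbrakk> \<Longrightarrow> Fm x y f \<in> Mor D (Fo x) (Fo y)"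
    and Fm_Idt: "x \<in> Obj C \<Longrightarrow> Fm x x (Idt C x) = Idt D (Fo x)"
    and Fm_Cmp: "\<lbrakk>x \<in> Obj C; y \<in> Obj C; z \<in> Obj C; f \<in> Mor C x y; g \<in> Mor C y z\<rbrakk>
      \<Longrightarrow> Fm x z (Cmp C x y z f g) = Cmp D (Fo x) (Fo y) (Fo z) (Fm x y f) (Fm y z g)"

text \<open>
  HOL cannot quantify over the types of the objects and morphisms of the finite category D inside
  a definition. Taking both to be the natural numbers loses nothing, since every finite category is
  isomorphic to one of this kind; see the lemma \<open>functor_to_nat_category\<close>.
\<close>

definition residually_finite :: "('o, 'm) precategory \<Rightarrow> bool" where
  "residually_finite C \<longleftrightarrow> category C \<and>
    (\<forall>x\<in>Obj C. \<forall>y\<in>Obj C. \<forall>x'\<in>Obj C. \<forall>y'\<in>Obj C. \<forall>f\<in>Mor C x y. \<forall>g\<in>Mor C x' y'.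
      (x, y, f) \<noteq> (x', y', g) \<longrightarrow>
      (\<exists>(D :: (nat, nat) precategory) Fo Fm. finite_category D \<and> category_functor C D Fo Fm \<and>
        (Fo x, Fo y, Fm x y f) \<noteq> (Fo x', Fo y', Fm x' y' g)))"

lemma functor_to_nat_category:
  fixes C :: "('o, 'm) precategory" and D :: "('p, 'n) precategory"
  assumes fin: "finite_category D" and F: "category_functor C D Fo Fm"
    and obj: "x \<in> Obj C" "y \<in> Obj C" "x' \<in> Obj C" "y' \<in> Obj C"
    and mor: "f \<in> Mor C x y" "g \<in> Mor C x' y'"
    and neq: "(Fo x, Fo y, Fm x y f) \<noteq> (Fo x', Fo y', Fm x' y' g)"
  shows "\<exists>(D' :: (nat, nat) precategory) Go Gm. finite_category D' \<and> category_functor C D' Go Gm \<and>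
    (Go x, Go y, Gm x y f) \<noteq> (Go x', Go y', Gm x' y' g)"
proof -
  interpret D: finite_category D by (fact fin)
  interpret F: category_functor C D Fo Fm by (fact F)
  define U where "U = (\<Union>p\<in>Obj D. \<Union>q\<in>Obj D. Mor D p q)"
  have "finite U" unfolding U_def using D.finite_Obj D.finite_Mor by blast
  obtain a :: "'p \<Rightarrow> nat" where a: "inj_on a (Obj D)"
    using finite_imp_inj_to_nat_seg[OF D.finite_Obj] by blast
  obtain b :: "'n \<Rightarrow> nat" where b: "inj_on b U"
    using finite_imp_inj_to_nat_seg[OF \<open>finite U\<close>] by blast
  define a' where "a' = inv_into (Obj D) a"
  define b' where "b' = inv_into U b"
  have a'a [simp]: "a' (a p) = p" if "p \<in> Obj D" for p
    using that a by (simp add: a'_def)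
  have b'b: "b' (b h) = h" if "p \<in> Obj D" "q \<in> Obj D" "h \<in> Mor D p q" for p q h
    using that b unfolding b'_def U_def by (intro inv_into_f_f) auto
  define D' :: "(nat, nat) precategory" where "D' =
    \<lparr> Obj = a ` Obj D,
      Mor = (\<lambda>p q. b ` Mor D (a' p) (a' q)),
      Idt = (\<lambda>p. b (Idt D (a' p))),
      Cmp = (\<lambda>p q r h k. b (Cmp D (a' p) (a' q) (a' r) (b' h) (b' k))) \<rparr>"
  have b'b_Idt: "b' (b (Idt D p)) = Idt D p" if "p \<in> Obj D" for p
    using that by (blast intro: b'b D.Idt_in)
  have b'b_Cmp: "b' (b (Cmp D p q r h k)) = Cmp D p q r h k"
    if "p \<in> Obj D" "q \<in> Obj D" "r \<in> Obj D" "h \<in> Mor D p q" "k \<in> Mor D q r" for p q r h k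
    using that by (blast intro: b'b D.Cmp_in)
  have "finite_category D'"
  proof
    show "Idt D' p \<in> Mor D' p p" if "p \<in> Obj D'" for p
      using that by (auto simp: D'_def D.Idt_in)
  next
    fix p q r h k
    assume "p \<in> Obj D'" "q \<in> Obj D'" "r \<in> Obj D'" "h \<in> Mor D' p q" "k \<in> Mor D' q r"
    then show "Cmp D' p q r h k \<in> Mor D' p r"
      by (clarsimp simp: D'_def) (metis D.Cmp_in b'b imageI)
  next
    fix p q h
    assume "p \<in> Obj D'" "q \<in> Obj D'" "h \<in> Mor D' p q"
    then show "Cmp D' p p q (Idt D' p) h = h" "Cmp D' p q q h (Idt D' q) = h"
      by (clarsimp simp: D'_def b'b_Idt, metis D.Cmp_Idt_left D.Cmp_Idt_right b'b)+
  next
    fix n p q r h k l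
    assume "n \<in> Obj D'" "p \<in> Obj D'" "q \<in> Obj D'" "r \<in> Obj D'"
      "h \<in> Mor D' n p" "k \<in> Mor D' p q" "l \<in> Mor D' q r"
    then obtain n1 p1 q1 r1 h1 k1 l1
      where *: "n1 \<in> Obj D" "p1 \<in> Obj D" "q1 \<in> Obj D" "r1 \<in> Obj D"
        "h1 \<in> Mor D n1 p1" "k1 \<in> Mor D p1 q1" "l1 \<in> Mor D q1 r1"
        "n = a n1" "p = a p1" "q = a q1" "r = a r1" "h = b h1" "k = b k1" "l = b l1"
      by (force simp: D'_def)
    have **: "b' (b h1) = h1" "b' (b k1) = k1" "b' (b l1) = l1"
      using * b'b by blast+
    show "Cmp D' n q r (Cmp D' n p q h k) l = Cmp D' n p r h (Cmp D' p q r k l)"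
      using *(1-7) unfolding *(8-14) by (simp add: D'_def ** b'b_Cmp D.Cmp_assoc)
  next
    show "finite (Obj D')" by (simp add: D'_def D.finite_Obj)
  next
    show "finite (Mor D' p q)" if "p \<in> Obj D'" "q \<in> Obj D'" for p q
      using that by (auto simp: D'_def D.finite_Mor)
  qed
  moreover define Go Gm where "Go = (\<lambda>u. a (Fo u))" and "Gm = (\<lambda>u v h. b (Fm u v h))"
  moreover have "category_functor C D' Go Gm"
  proof -
    interpret D': finite_category D' by fact
    have b'b_Fm: "b' (b (Fm u v h)) = Fm u v h"
      if "u \<in> Obj C" "v \<in> Obj C" "h \<in> Mor C u v" for u v h
      using that by (blast intro: b'b F.Fo_in F.Fm_in)
    show ?thesis
    proof
      show "Go u \<in> Obj D'" if "u \<in> Obj C" for u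
        using that by (simp add: D'_def Go_def F.Fo_in)
      show "Gm u v h \<in> Mor D' (Go u) (Go v)" if "u \<in> Obj C" "v \<in> Obj C" "h \<in> Mor C u v" for u v h
        using that by (simp add: D'_def Go_def Gm_def F.Fo_in F.Fm_in)
      show "Gm u u (Idt C u) = Idt D' (Go u)" if "u \<in> Obj C" for u
        using that by (simp add: D'_def Go_def Gm_def F.Fo_in F.Fm_Idt)
      show "Gm u w (Cmp C u v w h k) = Cmp D' (Go u) (Go v) (Go w) (Gm u v h) (Gm v w k)"
        if "u \<in> Obj C" "v \<in> Obj C" "w \<in> Obj C" "h \<in> Mor C u v" "k \<in> Mor C v w" for u v w h k
        using that by (simp add: D'_def Go_def Gm_def F.Fo_in F.Fm_Cmp b'b_Fm)
    qed
  qed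
  moreover have "(Go x, Go y, Gm x y f) \<noteq> (Go x', Go y', Gm x' y' g)"
  proof
    assume "(Go x, Go y, Gm x y f) = (Go x', Go y', Gm x' y' g)"
    then have "a (Fo x) = a (Fo x')" "a (Fo y) = a (Fo y')" "b (Fm x y f) = b (Fm x' y' g)"
      by (simp_all add: Go_def Gm_def)
    moreover have "Fm x y f \<in> U"
      unfolding U_def by (intro UN_I[of "Fo x"] UN_I[of "Fo y"] F.Fo_in F.Fm_in obj mor)
    moreover have "Fm x' y' g \<in> U"
      unfolding U_def by (intro UN_I[of "Fo x'"] UN_I[of "Fo y'"] F.Fo_in F.Fm_in obj mor)
    ultimately have "Fo x = Fo x'" "Fo y = Fo y'" "Fm x y f = Fm x' y' g"
      using F.Fo_in[OF obj(1)] F.Fo_in[OF obj(2)] F.Fo_in[OF obj(3)] F.Fo_in[OF obj(4)]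
      by (simp_all add: inj_on_eq_iff[OF a] inj_on_eq_iff[OF b])
    with neq show False by simp
  qed
  ultimately show ?thesis by (intro exI conjI)
qed

text \<open>
  A quiver is a well-formed digraph of the Graph-Theory library (with tail as source and head as target):
  multiple arcs and loops are allowed, and the sets of vertices and arcs may be infinite. A directed
  path from u to v is an arc walk, i.e. a list of arcs; the empty list is the empty path at every
  vertex, the vertex being determined by the hom-set.
\<close>

definition free_category :: "('v, 'e) pre_digraph \<Rightarrow> ('v, 'e list) precategory" where
  "free_category X =
    \<lparr> Obj = verts X,
      Mor = (\<lambda>u v. {p. pre_digraph.awalk X u p v}),
      Idt = (\<lambda>u. []),
      Cmp = (\<lambda>u v w p q. p @ q) \<rparr>"

lemma category_free_category:
  assumes "wf_digraph X"
  shows "category (free_category X)"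
proof -
  interpret wf_digraph X by (fact assms)
  show ?thesis
    by unfold_locales (auto simp: free_category_def awalk_Nil_iff
      simp del: awalk_append_iff intro: awalk_appendI)
qed

end

theory Submission
  imports Defs
begin

text \<open>
  A morphism of the free category is a triple of a start vertex, an end vertex and a word in the
  arcs. Finite quotients detect these data separately. For the words, fix a bound \<open>n\<close> and a
  finite set \<open>A\<close> of arcs, erase from each word the letters outside \<open>A\<close>, and cut the
  result after \<open>n\<close> letters. Erasing letters is a homomorphism of free monoids, and the first
  \<open>n\<close> letters of a concatenation depend only on the first \<open>n\<close> letters of each factor,
  so this is a homomorphism onto the finite monoid of words of length at most \<open>n\<close> over
  \<open>A\<close> with truncated concatenation. It fixes both given words once \<open>A\<close> contains their
  letters and \<open>n\<close> bounds their lengths.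

  For the endpoints, any map from the vertices to a finite set \<open>S\<close> extends to a functor into
  the codiscrete category on \<open>S\<close>; the map recording whether a vertex is the start, and whether
  it is the end, of the first morphism separates this morphism from every morphism with
  different endpoints. The product of the codiscrete category with the truncated monoid does
  both at once, with no case distinction between empty and nonempty paths.
\<close>

text \<open>
  The product of the codiscrete category on \<open>S\<close> with the monoid of words over \<open>A\<close>
  truncated at length \<open>n\<close>.
\<close>

definition truncated_words :: "'o set \<Rightarrow> 'e set \<Rightarrow> nat \<Rightarrow> ('o, 'e list) precategory" where
  "truncated_words S A n =
    \<lparr> Obj = S,
      Mor = (\<lambda>u v. {p. set p \<subseteq> A \<and> length p \<le> n}),
      Idt = (\<lambda>u. []),
      Cmp = (\<lambda>u v w p q. take n (p @ q)) \<rparr>"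

lemma take_append_take_right: "take n (p @ take n q) = take n (p @ q)"
  by (simp add: min_def)

lemma take_append_take_left: "take n (take n p @ q) = take n (p @ q)"
  by (cases "n \<le> length p") simp_all

lemma finite_category_truncated_words:
  assumes "finite S" "finite A"
  shows "finite_category (truncated_words S A n)"
  by unfold_locales
    (auto simp: truncated_words_def assms finite_lists_length_le
      take_append_take_right take_append_take_left
      simp del: take_append dest!: in_set_takeD)

text \<open>
  The action on vertices is arbitrary because no condition on morphisms of a codiscrete category
  relates them to their endpoints; functoriality is that erasing and truncating respect
  concatenation.
\<close>

lemma category_functor_truncated_words:
  assumes "wf_digraph X" "finite S" "finite A" "\<And>u. Fo u \<in> S"
  shows "category_functor (free_category X) (truncated_words S A n) Fo
    (\<lambda>u v p. take n (filter (\<lambda>e. e \<in> A) p))"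
proof -
  interpret C: category "free_category X"
    by (rule category_free_category) fact
  interpret D: finite_category "truncated_words S A n"
    by (rule finite_category_truncated_words) fact+
  show ?thesis
    by unfold_locales
      (auto simp: truncated_words_def free_category_def assms(4)
        take_append_take_right take_append_take_left
        simp del: take_append dest!: in_set_takeD)
qed

theorem proposition4p7:
  fixes X :: "('v, 'e) pre_digraph"
  assumes "wf_digraph X"
  shows "residually_finite (free_category X)"
  unfolding residually_finite_def
proof (intro conjI ballI impI)
  show "category (free_category X)"
    by (rule category_free_category) fact
next
  fix x y x' y' f g
  assume obj: "x \<in> Obj (free_category X)" "y \<in> Obj (free_category X)"
      "x' \<in> Obj (free_category X)" "y' \<in> Obj (free_category X)"
    and mor: "f \<in> Mor (free_category X) x y" "g \<in> Mor (free_category X) x' y'"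
    and neq: "(x, y, f) \<noteq> (x', y', g)"
  define A where "A = set f \<union> set g"
  define n where "n = max (length f) (length g)"
  define Fo where "Fo = (\<lambda>u. (u = x, u = y))"
  define Fm where "Fm = (\<lambda>(u::'v) (v::'v) p. take n (filter (\<lambda>e. e \<in> A) p))"
  have fin: "finite_category (truncated_words (UNIV :: (bool \<times> bool) set) A n)"
    by (rule finite_category_truncated_words) (simp_all add: A_def)
  have func: "category_functor (free_category X) (truncated_words UNIV A n) Fo Fm"
    unfolding Fm_def by (rule category_functor_truncated_words[OF assms]) (simp_all add: A_def)
  have "filter (\<lambda>e. e \<in> A) f = f" "filter (\<lambda>e. e \<in> A) g = g"
    by (simp_all add: A_def filter_id_conv)
  then have "Fm x y f = f" "Fm x' y' g = g"
    by (simp_all add: Fm_def n_def)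
  with neq have sep: "(Fo x, Fo y, Fm x y f) \<noteq> (Fo x', Fo y', Fm x' y' g)"
    by (auto simp: Fo_def)
  show "\<exists>(D :: (nat, nat) precategory) Fo Fm. finite_category D \<and>
      category_functor (free_category X) D Fo Fm \<and>
      (Fo x, Fo y, Fm x y f) \<noteq> (Fo x', Fo y', Fm x' y' g)"
    by (rule functor_to_nat_category[OF fin func obj mor sep])
qed

end
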